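(* For every prime power $q$, \[ \operatorname{diam}\Gamma^{s}(2,q)= \begin{cases} 0,&q=2,\\ 2,&q=3,\\ 3,&q\ge 4. \end{cases} \]
   Context: Let $q$ be a prime power and $V=\mathbb F_q^{q+1}$. A two-dimensional $q$-ary simplex code is a two-dimensional linear subspace of $V$ in which every non-zero vector has Hamming weight $q$, i.e. has exactly one zero coordinate. The graph $\Gamma^{s}(2,q)$ has as vertices all two-dimensional $q$-ary simplex codes in $V$; two distinct vertices are adjacent if and only if their intersection is one-dimensional. (It is the subgraph induced by these codes in the Grassmann graph of two-dimensional subspaces of $V$.) The diameter $\operatorname{diam}$ of a graph is the maximum path distance between two vertices. *)

theory Defs
  imports
    "HOL-Analysis.Analysis"
    "HOL-Number_Theory.Prime_Powers"
    "Graph_Theory.Graph_Theory"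
begin

definition hamming_weight :: "'k::zero ^ 'n::finite \<Rightarrow> nat" where
  "hamming_weight x = card {i. x $ i \<noteq> 0}"

text \<open>The field with \<open>q\<close> elements is a finite field type \<open>'k\<close> with \<open>CARD('k) = q\<close>; the ambient
  space has coordinates indexed by \<open>'n\<close>, where \<open>CARD('n) = q + 1\<close> is required in the theorem. The
  constants \<open>vec.subspace\<close> and \<open>vec.dim\<close> refer to the \<open>'k\<close>-linear structure.\<close>

definition simplex_code2 :: "('k::{field,finite} ^ 'n::finite) set \<Rightarrow> bool" where
  "simplex_code2 C \<longleftrightarrow> vec.subspace C \<and> vec.dim C = 2 \<and>
     (\<forall>x\<in>C. x \<noteq> 0 \<longrightarrow> hamming_weight x = CARD('k))"

text \<open>As usual in \<open>Graph_Theory\<close>, an undirected edge is a pair of opposite arcs.\<close>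

definition simplex_graph2 :: "('k::{field,finite} ^ 'n::finite) set pair_pre_digraph" where
  "simplex_graph2 =
     \<lparr> pverts = {C. simplex_code2 C},
       parcs = {(C, D). simplex_code2 C \<and> simplex_code2 D \<and> C \<noteq> D \<and> vec.dim (C \<inter> D) = 1} \<rparr>"

lemma wf_digraph_simplex_graph2: "wf_digraph (with_proj simplex_graph2)"
  by unfold_locales (auto simp: simplex_graph2_def)

text \<open>Distances are lengths of shortest walks, that is, \<open>\<mu>\<close> for unit arc weights; they lie in
  \<open>ereal\<close>, with value \<open>\<infinity>\<close> between different components. For a finite graph with at least one vertex
  the supremum is a maximum (for the graph without vertices it is \<open>-\<infinity>\<close>).\<close>

definition graph_diameter :: "('v, 'e) pre_digraph \<Rightarrow> ereal" where
  "graph_diameter G = (SUP (u, v) \<in> verts G \<times> verts G. wf_digraph.\<mu> G (\<lambda>_. 1) u v)"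

end

theory Submission
  imports Defs
begin

text \<open>
  Two vectors \<open>x\<close>, \<open>y\<close> generate a simplex code exactly when the columns \<open>(x $ i, y $ i)\<close> are
  nonzero and pairwise non-proportional: they then run through the whole projective line, so
  every nonzero combination vanishes exactly once. The predicate \<open>separated\<close> expresses this by
  the two-by-two minors. If \<open>x\<close> vanishes exactly at \<open>i\<close> and \<open>y\<close> exactly at \<open>j\<close>, it means that
  \<open>i \<noteq> j\<close> and that the ratios \<open>x $ k / y $ k\<close>, for \<open>k \<notin> {i, j}\<close>, run through all nonzero field
  elements (\<open>separated_ratio_bij\<close>, \<open>separatedI\<close>). Two distinct simplex codes are adjacent if
  and only if they share a nonzero vector.

  \<^emph>\<open>Distance at most three.\<close> Given codes \<open>C\<close> and \<open>D\<close>, take \<open>x \<in> C\<close> and \<open>y \<in> D\<close> with zeros at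
  different places \<open>i\<close> and \<open>j\<close>. It suffices to find \<open>z\<close> such that \<open>x, z\<close> and \<open>y, z\<close> both
  generate simplex codes, because then \<open>C\<close>, \<open>\<langle>x, z\<rangle>\<close>, \<open>\<langle>y, z\<rangle>\<close>, \<open>D\<close> is a walk (possibly with
  repetitions). Letting \<open>z\<close> vanish at a third place \<open>m\<close>, the entries of \<open>z\<close> away from \<open>i, j,
  m\<close> are \<open>q - 2\<close> unknowns that must be distinct and nonzero relative to \<open>x\<close> and also relative
  to \<open>y\<close>. They exist by a case of a theorem of M. Hall on sums of permutations of an abelian
  group (\<open>distinct_multiples\<close>); the entries at \<open>i\<close> and \<open>j\<close> are constrained by only one of the
  two conditions each and take the value left over.

  \<^emph>\<open>Distance at least three.\<close> Codes with trivial intersection are at distance at least three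
  as soon as no \<open>x \<in> C\<close> and \<open>y \<in> D\<close> are separated. For \<open>q \<ge> 5\<close> one rescales three coordinates
  of any code by an element \<open>g\<close> with \<open>g, g\<^sup>2, g\<^sup>3 \<noteq> 1\<close>: for separated vectors the product of
  the ratios is always the product of all nonzero field elements, which forces one of these
  powers to be \<open>1\<close> (\<open>rescaled_code_separated\<close>). In the multiplicative group of order three of
  the field with four elements no such \<open>g\<close> exists. There an explicit pair works: separated
  vectors are orthogonal for the Hermitian form, since the nonzero field elements add up to
  zero, whereas orthogonal nonzero vectors of the two chosen codes vanish at the same place
  (\<open>far_codes_4\<close>).

  \<^emph>\<open>Three and two elements.\<close> For \<open>q = 3\<close> the two nonzero elements are \<open>1\<close> and \<open>-1\<close>, so that
  vectors with one zero each are separated if and only if they are orthogonal and their zeros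
  differ. A vector \<open>x \<in> C\<close> is always orthogonal to some nonzero \<open>y \<in> D\<close>, which gives distance
  at most two (\<open>within_two_card_3\<close>). For \<open>q = 2\<close> a nonzero vector of a simplex code is
  determined by its zero, so there is only one code.
\<close>

section \<open>Distances and powers of the adjacency relation\<close>

lemma pcas_imp_relpow:
  "pcas u p v \<Longrightarrow> set p \<subseteq> R \<Longrightarrow> (u, v) \<in> R ^^ length p"
  by (induction p arbitrary: u) (auto intro: relpow_Suc_I2 simp del: relpow.simps(2))

lemma relpow_imp_pcas:
  "(u, v) \<in> R ^^ n \<Longrightarrow> \<exists>p. pcas u p v \<and> set p \<subseteq> R \<and> length p = n"
proof (induction n arbitrary: u)
  case (Suc n)
  then obtain w where w: "(u, w) \<in> R" "(w, v) \<in> R ^^ n"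
    by (meson relpow_Suc_D2)
  with Suc.IH obtain p where "pcas w p v" "set p \<subseteq> R" "length p = n" by blast
  with w(1) show ?case by (intro exI[of _ "(u, w) # p"]) auto
qed simp

lemma relpow_reflcl_imp: "(u, v) \<in> (R\<^sup>=) ^^ n \<Longrightarrow> \<exists>m\<le>n. (u, v) \<in> R ^^ m"
proof (induction n arbitrary: v)
  case (Suc n)
  then obtain w where "(u, w) \<in> (R\<^sup>=) ^^ n" "(w, v) \<in> R\<^sup>=" by auto
  with Suc.IH obtain m where "m \<le> n" "(u, w) \<in> R ^^ m" by blast
  show ?case
  proof (cases "w = v")
    case True
    with \<open>m \<le> n\<close> \<open>(u, w) \<in> R ^^ m\<close> show ?thesis using le_SucI by blast
  next
    case False
    with \<open>(w, v) \<in> R\<^sup>=\<close> \<open>(u, w) \<in> R ^^ m\<close> have "(u, v) \<in> R ^^ Suc m" by auto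
    with \<open>m \<le> n\<close> show ?thesis by (meson Suc_le_mono)
  qed
qed simp

context
  fixes G :: "'a pair_pre_digraph"
  assumes wf: "wf_digraph (with_proj G)"
begin

lemma awalk_cost_one: "wf_digraph.awalk_cost (\<lambda>_. 1) p = real (length (p :: ('a \<times> 'a) list))"
  by (induction p) (simp_all add: wf_digraph.awalk_cost_Nil[OF wf] wf_digraph.awalk_cost_Cons[OF wf])

lemma unit_dist_le:
  assumes "u \<in> pverts G" "(u, v) \<in> parcs G ^^ m" "m \<le> n"
  shows "wf_digraph.\<mu> (with_proj G) (\<lambda>_. 1) u v \<le> ereal (real n)"
proof -
  obtain p where p: "pcas u p v" "set p \<subseteq> parcs G" "length p = m"
    using relpow_imp_pcas[OF assms(2)] by blast
  then have "pre_digraph.awalk (with_proj G) u p v"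
    using assms(1) by (simp add: pre_digraph.awalk_def cas_with_proj_eq)
  from wf_digraph.min_cost_le_walk_cost[OF wf this, of "\<lambda>_. 1"]
  have "wf_digraph.\<mu> (with_proj G) (\<lambda>_. 1) u v \<le> ereal (real m)"
    using p(3) by (simp add: awalk_cost_one)
  also have "\<dots> \<le> ereal (real n)" using assms(3) by simp
  finally show ?thesis .
qed

lemma unit_dist_ge:
  assumes "\<And>m. m < n \<Longrightarrow> (u, v) \<notin> parcs G ^^ m"
  shows "ereal (real n) \<le> wf_digraph.\<mu> (with_proj G) (\<lambda>_. 1) u v"
  unfolding wf_digraph.\<mu>_def[OF wf]
proof (rule INF_greatest)
  fix p assume "p \<in> {p. pre_digraph.awalk (with_proj G) u p v}"
  then have "pcas u p v" "set p \<subseteq> parcs G"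
    by (simp_all add: pre_digraph.awalk_def cas_with_proj_eq)
  then have "(u, v) \<in> parcs G ^^ length p" by (rule pcas_imp_relpow)
  with assms have "n \<le> length p" by (meson not_le)
  then show "ereal (real n) \<le> ereal (wf_digraph.awalk_cost (\<lambda>_. 1) p)"
    by (simp add: awalk_cost_one)
qed

lemma graph_diameter_eqI:
  assumes "\<And>u v. u \<in> pverts G \<Longrightarrow> v \<in> pverts G \<Longrightarrow> \<exists>m\<le>n. (u, v) \<in> parcs G ^^ m"
    and "u \<in> pverts G" "v \<in> pverts G" "\<And>m. m < n \<Longrightarrow> (u, v) \<notin> parcs G ^^ m"
  shows "graph_diameter (with_proj G) = ereal (real n)"
proof (rule antisym)
  show "graph_diameter (with_proj G) \<le> ereal (real n)"
    unfolding graph_diameter_def using assms(1) by (auto intro!: SUP_least dest: unit_dist_le)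
  have "ereal (real n) \<le> wf_digraph.\<mu> (with_proj G) (\<lambda>_. 1) u v"
    by (rule unit_dist_ge) (use assms(4) in auto)
  also have "\<dots> \<le> graph_diameter (with_proj G)"
    unfolding graph_diameter_def
    by (rule SUP_upper2[of "(u, v)"]) (use assms(2,3) in auto)
  finally show "ereal (real n) \<le> graph_diameter (with_proj G)" .
qed

end

section \<open>Multipliers that keep values distinct\<close>

text \<open>
  A multiplicative case of M. Hall's theorem on differences of permutations in abelian groups.
  Given a solution \<open>z\<close> on \<open>K\<close>, with \<open>w k = u k * z k\<close>, a further index \<open>m\<close> may find no free
  value directly. The map that sends a pair \<open>(z k, w k)\<close> to \<open>(S / w k, S / z k)\<close> keeps the
  quotient \<open>u k\<close>. Choosing two free values \<open>a \<noteq> b\<close> for \<open>z\<close> and \<open>S = u m * a * b\<close>, the index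
  \<open>m\<close> with the value \<open>a\<close> produces the product \<open>S / b\<close>. If that product is taken, its holder is
  reflected by this map and receives the free value \<open>b\<close>; its new product may again be taken,
  and so on. The indices of this chain form the set \<open>P\<close> below, and reflecting all of them at
  once leaves no conflict.
\<close>

lemma distinct_multiples:
  fixes u :: "'i \<Rightarrow> 'k::{field,finite}"
  assumes "finite K" "card K + 2 \<le> CARD('k)" "\<And>k. k \<in> K \<Longrightarrow> u k \<noteq> 0"
  shows "\<exists>z. (\<forall>k\<in>K. z k \<noteq> 0) \<and> inj_on z K \<and> inj_on (\<lambda>k. u k * z k) K"
  using assms
proof (induction K rule: finite_induct)
  case (insert m K)
  then obtain z where z: "\<And>k. k \<in> K \<Longrightarrow> z k \<noteq> 0" "inj_on z K" "inj_on (\<lambda>k. u k * z k) K"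
    by fastforce
  define w where "w = (\<lambda>k. u k * z k)"
  have w: "w k \<noteq> 0" "w k = u k * z k" if "k \<in> K" for k
    using that z insert.prems by (auto simp: w_def)
  have w_inj: "inj_on w K" using z(3) by (simp add: w_def)
  have um: "u m \<noteq> 0" using insert.prems by simp
  have "card (insert 0 (z ` K)) < CARD('k)"
    using insert by (simp add: card_image z(2) card_insert_if)
  then obtain a where a: "a \<notin> insert 0 (z ` K)"
    by (metis card_mono finite not_le subsetI)
  have "card (insert a (insert 0 (z ` K))) < CARD('k)"
    using insert by (simp add: card_image z(2) card_insert_if)
  then obtain b where b: "b \<notin> insert a (insert 0 (z ` K))"
    by (metis card_mono finite not_le subsetI)
  define S where "S = u m * a * b"
  have nz: "a \<noteq> 0" "b \<noteq> 0" "a \<noteq> b" "S \<noteq> 0" using a b um by (auto simp: S_def)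
  \<comment> \<open>Only the fixed point equation is used: it says that an index outside \<open>P\<close> does not clash with
    the products \<open>S / b\<close> and \<open>S / z j\<close>, \<open>j \<in> P\<close>, and that the new values on \<open>P\<close> are \<open>b\<close> or old values on \<open>P\<close>.\<close>
  define P where "P = lfp (\<lambda>Q. {k \<in> K. w k * b = S \<or> (\<exists>j\<in>Q. w k * z j = S)})"
  have P_iff: "k \<in> P \<longleftrightarrow> k \<in> K \<and> (w k * b = S \<or> (\<exists>j\<in>P. w k * z j = S))" for k
  proof -
    have "mono (\<lambda>Q. {k \<in> K. w k * b = S \<or> (\<exists>j\<in>Q. w k * z j = S)})"
      by (rule monoI) blast
    from lfp_unfold[OF this, folded P_def] show ?thesis by blast
  qed
  then have PK: "P \<subseteq> K" by blast
  define z' where "z' = (\<lambda>k. if k = m then a else if k \<in> P then S / w k else z k)"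
  have mK: "m \<notin> K" by fact
  have z'_in: "z' k \<in> insert b (z ` P)" if "k \<in> P" for k
    using that P_iff[of k] w(1)[of k] mK by (auto simp: z'_def field_simps image_iff)
  have z'_out: "z' k = z k" if "k \<in> K" "k \<notin> P" for k
    using that mK by (auto simp: z'_def)
  have w'_m: "u m * z' m = S / b"
    using nz by (simp add: z'_def S_def)
  have w'_in: "u k * z' k = S / z k" if "k \<in> P" for k
    using that PK mK z(1)[of k] w[of k] by (auto simp: z'_def field_simps)
  have sep: "z' k \<noteq> z' l" "u k * z' k \<noteq> u l * z' l" if "k \<in> P" "l \<in> K" "l \<notin> P" for k l
  proof -
    show "z' k \<noteq> z' l"
      using z'_in[OF that(1)] z'_out[OF that(2,3)] b that PK inj_onD[OF z(2)] by fastforce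
    have "w l * z k \<noteq> S" using P_iff[of l] that by blast
    then show "u k * z' k \<noteq> u l * z' l"
      using w'_in[OF that(1)] z'_out[OF that(2,3)] w(2)[OF that(2)] z(1)[of k] that(1) PK
      by (auto simp: field_simps)
  qed
  have "inj_on z' K"
  proof (rule inj_onI)
    fix k l assume kl: "k \<in> K" "l \<in> K" "z' k = z' l"
    consider "k \<in> P" "l \<in> P" | "k \<notin> P" "l \<notin> P" using sep(1) kl by metis
    then show "k = l"
    proof cases
      case 1
      then have "w k = w l" using kl mK w(1) nz by (auto simp: z'_def split: if_splits)
      then show ?thesis using w_inj kl by (auto dest: inj_onD)
    next
      case 2
      then show ?thesis using kl z'_out z(2) by (auto dest: inj_onD)
    qed
  qed
  moreover have "z' k \<noteq> a" if "k \<in> K" for k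
    using that z'_in[of k] z'_out[of k] a nz PK by fastforce
  moreover have "inj_on (\<lambda>k. u k * z' k) K"
  proof (rule inj_onI)
    fix k l assume kl: "k \<in> K" "l \<in> K" "u k * z' k = u l * z' l"
    consider "k \<in> P" "l \<in> P" | "k \<notin> P" "l \<notin> P" using sep(2) kl by metis
    then show "k = l"
    proof cases
      case 1
      then have "z k = z l" using kl nz z(1) by (simp add: w'_in)
      then show ?thesis using z(2) kl by (auto dest: inj_onD)
    next
      case 2
      then show ?thesis using kl z'_out z(3) by (auto dest: inj_onD)
    qed
  qed
  moreover have "u k * z' k \<noteq> S / b" if "k \<in> K" for k
  proof (cases "k \<in> P")
    case True
    then show ?thesis using w'_in[of k] z(1)[of k] that b nz by auto
  next
    case False
    then have "w k * b \<noteq> S" using P_iff that by blast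
    then show ?thesis using False z'_out[OF that] w(2)[OF that] nz by (auto simp: field_simps)
  qed
  moreover have "z' m = a" by (simp add: z'_def)
  moreover have "z' k \<noteq> 0" if "k \<in> K" for k
    using that mK nz z(1) w(1) by (auto simp: z'_def)
  ultimately have "(\<forall>k\<in>insert m K. z' k \<noteq> 0) \<and> inj_on z' (insert m K) \<and>
      inj_on (\<lambda>k. u k * z' k) (insert m K)"
    using nz w'_m mK by (auto simp: inj_on_insert) (metis+)
  then show ?case by blast
qed simp

section \<open>Pairs of vectors with non-proportional columns\<close>

definition separated :: "'k::field ^ 'n \<Rightarrow> 'k ^ 'n \<Rightarrow> bool" where
  "separated x y \<longleftrightarrow> (\<forall>i j. i \<noteq> j \<longrightarrow> x $ i * y $ j \<noteq> x $ j * y $ i)"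

lemma separatedD: "separated x y \<Longrightarrow> i \<noteq> j \<Longrightarrow> x $ i * y $ j \<noteq> x $ j * y $ i"
  by (simp add: separated_def)

lemma separated_sym: "separated x y \<Longrightarrow> separated y x"
  by (auto simp: separated_def mult.commute)

lemma span_pair_iff:
  "v \<in> vec.span {x, y} \<longleftrightarrow> (\<exists>a b. v = a *s x + b *s (y :: 'k::field ^ 'n))"
proof -
  have "v \<in> vec.span {x, y} \<longleftrightarrow> (\<exists>a b. v - a *s x = b *s y)"
    by (auto simp: vec.span_breakdown_eq[of v x] vec.span_singleton)
  also have "\<dots> \<longleftrightarrow> (\<exists>a b. v = a *s x + b *s y)"
    by (simp add: algebra_simps)
  finally show ?thesis .
qed

lemma separated_comb_zero_unique:
  fixes x y :: "'k::field ^ 'n"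
  assumes "separated x y" "i \<noteq> j"
    and "a * x $ i + b * y $ i = 0" "a * x $ j + b * y $ j = 0"
  shows "a = 0 \<and> b = 0"
proof -
  have "a * (x $ i * y $ j - x $ j * y $ i) =
      (a * x $ i + b * y $ i) * y $ j - (a * x $ j + b * y $ j) * y $ i"
    by (simp add: algebra_simps)
  moreover have "b * (x $ i * y $ j - x $ j * y $ i) =
      (a * x $ j + b * y $ j) * x $ i - (a * x $ i + b * y $ i) * x $ j"
    by (simp add: algebra_simps)
  moreover have "x $ i * y $ j - x $ j * y $ i \<noteq> 0"
    using assms(1,2) by (simp add: separated_def)
  ultimately show ?thesis using assms(3,4) by auto
qed

text \<open>
  If \<open>v = a x + b y\<close> had no zero, the columns \<open>(x $ i, y $ i)\<close> could be normalised by \<open>v $ i\<close>.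
  They would then lie on an affine line, which has too few points for them all to be distinct.
\<close>

lemma separated_comb_zero_exists:
  fixes x y :: "'k::{field,finite} ^ 'n::finite"
  assumes "separated x y" "CARD('k) < CARD('n)"
  shows "\<exists>i. a * x $ i + b * y $ i = 0"
proof (rule ccontr)
  assume nz: "\<nexists>i. a * x $ i + b * y $ i = 0"
  define v where "v i = a * x $ i + b * y $ i" for i
  have v: "v i \<noteq> 0" for i using nz by (auto simp: v_def)
  have "\<exists>f :: 'n \<Rightarrow> 'k. inj f"
  proof (cases "b = 0")
    case False
    have "inj (\<lambda>i. x $ i / v i)"
    proof (rule injI)
      fix i j assume "x $ i / v i = x $ j / v j"
      then have "b * (x $ i * y $ j) = b * (x $ j * y $ i)"
        using v[of i] v[of j] by (simp add: field_simps) (simp add: v_def algebra_simps)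
      then show "i = j" using assms(1) False by (auto simp: separated_def)
    qed
    then show ?thesis by blast
  next
    case True
    have "inj (\<lambda>i. y $ i / v i)"
    proof (rule injI)
      fix i j assume "y $ i / v i = y $ j / v j"
      then have "a * (x $ i * y $ j) = a * (x $ j * y $ i)"
        using v[of i] v[of j] by (simp add: field_simps) (simp add: v_def True algebra_simps)
      then show "i = j" using assms(1) True v[of i] by (auto simp: separated_def v_def)
    qed
    then show ?thesis by blast
  qed
  then have "CARD('n) \<le> CARD('k)" by (metis card_inj_on_le finite top_greatest)
  with assms(2) show False by simp
qed

definition rescale :: "('n \<Rightarrow> 'k::semiring_1) \<Rightarrow> 'k ^ 'n \<Rightarrow> 'k ^ 'n" where
  "rescale d x = (\<chi> k. d k * x $ k)"

lemma rescale_nth [simp]: "rescale d x $ k = d k * x $ k"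
  by (simp add: rescale_def)

lemma separated_rescale:
  fixes x y :: "'k::field ^ 'n"
  assumes "separated x y" "\<And>k. d k \<noteq> 0"
  shows "separated (rescale d x) (rescale d y)"
  using assms by (auto simp: separated_def mult.assoc mult.left_commute[of "x $ _"])

lemma span_rescale_iff:
  fixes x y :: "'k::field ^ 'n::finite"
  shows "v \<in> vec.span {rescale d x, rescale d y} \<longleftrightarrow>
    (\<exists>w\<in>vec.span {x, y}. v = rescale d w)"
proof -
  have "a *s rescale d x + b *s rescale d y = rescale d (a *s x + b *s y)" for a b
    by (simp add: vec_eq_iff algebra_simps)
  then show ?thesis unfolding Bex_def span_pair_iff by metis
qed

section \<open>Small orders and small fields\<close>

text \<open>
  At most four nonzero elements satisfy \<open>g\<^sup>2 = 1\<close> or \<open>g\<^sup>3 = 1\<close>, namely \<open>1\<close>, \<open>-1\<close> and the roots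
  of \<open>g\<^sup>2 + g + 1\<close>. This leaves one if there are at least six elements. With five elements
  \<open>g\<^sup>4 = 1\<close> holds for all nonzero \<open>g\<close>, so that \<open>g\<^sup>3 = 1\<close> forces \<open>g = 1\<close>.
\<close>

lemma exists_order_ge_4:
  assumes "CARD('k::{field,finite}) \<ge> 5"
  shows "\<exists>g::'k. g \<noteq> 0 \<and> g ^ 2 \<noteq> 1 \<and> g ^ 3 \<noteq> 1"
proof (cases "CARD('k) = 5")
  case True
  have "card {0, 1, -1 :: 'k} < CARD('k)" using True by (simp add: card_insert_if)
  then obtain g :: 'k where g: "g \<notin> {0, 1, -1}" by (metis card_mono finite not_le subsetI)
  \<comment> \<open>Multiplication by \<open>g\<close> permutes the four nonzero elements, hence \<open>g\<^sup>4 = 1\<close>.\<close>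
  have "(\<Prod>y\<in>UNIV - {0}. g * y) = \<Prod>(UNIV - {0})"
    by (rule prod.reindex_bij_witness[of _ "\<lambda>y. y / g" "\<lambda>y. g * y"]) (use g in auto)
  then have "g ^ 4 * \<Prod>(UNIV - {0}) = \<Prod>(UNIV - {0})"
    using True by (simp add: prod.distrib)
  then have "g ^ 4 = 1" by (simp add: prod_zero_iff)
  moreover have "g ^ 4 = g * g ^ 3" by (simp add: power_Suc[symmetric] del: power_Suc)
  ultimately have "g ^ 3 \<noteq> 1" using g by auto
  then show ?thesis using g by (auto simp: power2_eq_1_iff)
next
  case False
  \<comment> \<open>If the quadratic has no root, any \<open>r\<close> will do.\<close>
  obtain r :: 'k where r: "\<And>x. x ^ 2 + x + 1 = 0 \<Longrightarrow> x = r \<or> x = - 1 - r"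
  proof (cases "\<exists>r::'k. r ^ 2 + r + 1 = 0")
    case True
    then obtain r :: 'k where r: "r ^ 2 + r + 1 = 0" by blast
    have "x = r \<or> x = - 1 - r" if "x ^ 2 + x + 1 = 0" for x
    proof -
      have "(x - r) * (x + r + 1) = (x ^ 2 + x + 1) - (r ^ 2 + r + 1)" by algebra
      with r that have "x - r = 0 \<or> x + r + 1 = 0" by simp
      moreover have "x = - 1 - r" if "x + r + 1 = 0"
      proof -
        have "x = (x + r + 1) + (- 1 - r)" by simp
        also have "\<dots> = - 1 - r" by (simp only: that add_0)
        finally show ?thesis .
      qed
      ultimately show ?thesis by auto
    qed
    with that show ?thesis by blast
  qed (use that in blast)
  have "card {0, 1, -1, r, -1 - r} \<le> 5" by (simp add: card_insert_if)
  also have "\<dots> < CARD('k)" using assms False by simp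
  finally obtain g :: 'k where g: "g \<notin> {0, 1, -1, r, -1 - r}"
    by (metis card_mono finite not_le subsetI)
  have "(g - 1) * (g ^ 2 + g + 1) = g ^ 3 - 1" by algebra
  with g r[of g] have "g ^ 3 \<noteq> 1" by auto
  with g show ?thesis by (auto simp: power2_eq_1_iff)
qed

lemma field_3:
  fixes c :: "'k::{field,finite}"
  assumes "CARD('k) = 3"
  shows "(1 :: 'k) + 1 = - 1" "(1 :: 'k) \<noteq> - 1" "c \<noteq> 0 \<Longrightarrow> c = 1 \<or> c = (- 1 :: 'k)"
proof -
  have three: "c = 0 \<or> c = 1 \<or> c = e" if "e \<noteq> 0" "e \<noteq> 1" for c e :: 'k
  proof (rule ccontr)
    assume "\<not> ?thesis"
    then have "card {0, 1, e, c} = 4" using that by auto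
    moreover have "card {0, 1, e, c} \<le> CARD('k)" by (rule card_mono) auto
    ultimately show False using assms by simp
  qed
  show ne: "(1 :: 'k) \<noteq> - 1"
  proof
    assume eq: "(1 :: 'k) = - 1"
    have "card {0, 1 :: 'k} < CARD('k)" using assms by simp
    then obtain e :: 'k where e: "e \<notin> {0, 1}" by (metis card_mono finite not_le subsetI)
    have "e + 1 \<noteq> 0" using e eq by (metis add_eq_0_iff2 insertCI)
    with three[of e "e + 1"] e show False by auto
  qed
  show "c \<noteq> 0 \<Longrightarrow> c = 1 \<or> c = (- 1 :: 'k)" using three[of "- 1" c] ne by auto
  have "(1 :: 'k) + 1 \<noteq> 0" using ne by (metis add_eq_0_iff2)
  moreover have "(1 :: 'k) + 1 \<noteq> 1" by (metis add_cancel_left_right zero_neq_one)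
  ultimately show "(1 :: 'k) + 1 = - 1" using three[of "- 1" "1 + 1"] ne
    by (metis neg_equal_0_iff_equal zero_neq_one)
qed

text \<open>The complete operation tables allow explicit vectors to be checked by rewriting.\<close>

lemma field_4:
  assumes q: "CARD('k::{field,finite}) = 4"
  obtains w v :: "'k::{field,finite}" where "UNIV = {0, 1, w, v}" "distinct [0, 1, w, v]"
    "w * w = v" "v * v = w" "w * v = 1" "v * w = 1" "\<And>x :: 'k. x + x = 0"
    "1 + w = v" "w + 1 = v" "1 + v = w" "v + 1 = w" "w + v = 1" "v + w = 1"
proof -
  have "(\<Sum>x\<in>UNIV. x + 1) = (\<Sum>x\<in>UNIV. x :: 'k)"
    by (rule sum.reindex_bij_witness[of _ "\<lambda>x. x - 1" "\<lambda>x. x + 1"]) auto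
  then have "of_nat CARD('k) = (0 :: 'k)" by (simp add: sum.distrib)
  then have "(1 + 1) * (1 + 1) = (0 :: 'k)" using q by simp
  then have "1 + 1 = (0 :: 'k)" by (metis mult_eq_0_iff)
  then have char2: "x + x = 0" for x :: 'k by (metis distrib_left mult.right_neutral mult_zero_right)
  have "card {0, 1 :: 'k} < CARD('k)" using q by simp
  then obtain w :: 'k where w: "w \<notin> {0, 1}" by (metis card_mono finite not_le subsetI)
  define v where "v = w + 1"
  have wv: "w + v = 1" "1 + v = w"
    using char2[of w] char2[of 1] by (simp_all add: v_def add.left_commute flip: add.assoc)
  have "v + 1 = w" using char2[of 1] by (simp only: v_def add.assoc add_0_right)
  then have "v \<noteq> 0" using w by auto
  then have dist: "distinct [0, 1, w, v]" using w by (auto simp: v_def)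
  have "card {0, 1, w, v} = CARD('k)" using dist q by simp
  then have U: "UNIV = {0, 1, w, v}" by (metis card_subset_eq finite subset_UNIV)
  have ww: "w * w = v"
  proof -
    have "w * w \<noteq> 0" "w * w \<noteq> w" using w by auto
    moreover have "w * w \<noteq> 1"
    proof
      assume "w * w = 1"
      then have "v * v = 0" using char2[of w] char2[of 1] by (simp add: v_def algebra_simps)
      with dist show False by simp
    qed
    ultimately show ?thesis using U by blast
  qed
  have wv1: "w * v = 1" using ww wv by (simp add: v_def distrib_left add.commute)
  have vv: "v * v = w" using wv1 \<open>v + 1 = w\<close> by (simp add: v_def distrib_right)
  have comm: "v * w = 1" "1 + w = v" "w + 1 = v" "v + w = 1"
    using wv1 wv by (simp_all add: v_def mult.commute add.commute)
  show ?thesis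
    by (rule that[OF U dist ww vv wv1 comm(1) char2 comm(2,3) wv(2) \<open>v + 1 = w\<close> wv(1) comm(4)])
qed

section \<open>Two-dimensional simplex codes\<close>

context
  assumes card_n: "CARD('n::finite) = CARD('k::{field,finite}) + 1"
begin

lemma two_coordinates: "\<exists>i j :: 'n. i \<noteq> j"
  using card_le_Suc0_iff_eq[of "UNIV :: 'n set"] card_n by auto

lemma weight_eq_iff:
  fixes v :: "'k ^ 'n"
  shows "hamming_weight v = CARD('k) \<longleftrightarrow> (\<exists>!i. v $ i = 0)"
proof -
  have "hamming_weight v + card {i. v $ i = 0} = CARD('n)"
    unfolding hamming_weight_def
    by (subst card_Un_disjoint[symmetric]) (auto intro: arg_cong[where f = card])
  then have "hamming_weight v = CARD('k) \<longleftrightarrow> card {i. v $ i = 0} = 1"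
    using card_n by linarith
  also have "\<dots> \<longleftrightarrow> (\<exists>!i. v $ i = 0)"
    by (auto simp: card_1_singleton_iff set_eq_iff Ex1_def)
  finally show ?thesis .
qed

lemma simplex_code_span:
  fixes x y :: "'k ^ 'n"
  assumes "separated x y"
  shows "simplex_code2 (vec.span {x, y})"
  unfolding simplex_code2_def
proof (intro conjI ballI impI)
  obtain i j :: 'n where ij: "i \<noteq> j" using two_coordinates by blast
  have "vec.independent {x, y}" "x \<noteq> y"
  proof -
    show "x \<noteq> y" using assms ij by (auto simp: separated_def mult.commute)
    have "y \<noteq> 0" using assms ij by (auto simp: separated_def)
    moreover have "x \<noteq> a *s y" for a
      using assms ij by (auto simp: separated_def mult.commute mult.left_commute)
    ultimately show "vec.independent {x, y}"
      by (auto simp: vec.independent_insert vec.span_singleton)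
  qed
  then show "vec.dim (vec.span {x, y}) = 2"
    by (simp add: vec.dim_eq_card_independent)
  fix v assume "v \<in> vec.span {x, y}" "v \<noteq> 0"
  then obtain a b where v: "v = a *s x + b *s y" "a \<noteq> 0 \<or> b \<noteq> 0"
    unfolding span_pair_iff by (metis add_0 vec.scale_zero_left)
  have "\<exists>i. v $ i = 0"
    using separated_comb_zero_exists[OF assms, of a b] card_n by (simp add: v(1))
  moreover have "i = j" if "v $ i = 0" "v $ j = 0" for i j
    using separated_comb_zero_unique[OF assms, of i j a b] that v by auto
  ultimately show "hamming_weight v = CARD('k)" unfolding weight_eq_iff by blast
qed simp

text \<open>The columns are the points of the projective line over the field: one at infinity,
  the others given by all field elements.\<close>

lemma separated_exists: "\<exists>x y :: 'k ^ 'n. separated x y"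
proof -
  obtain i :: 'n where True by blast
  have "card (UNIV - {i}) = CARD('k)" using card_n by simp
  then obtain f :: "'n \<Rightarrow> 'k" where f: "bij_betw f (UNIV - {i}) UNIV"
    by (metis finite finite_same_card_bij)
  have inj: "f k = f l \<Longrightarrow> k \<noteq> i \<Longrightarrow> l \<noteq> i \<Longrightarrow> k = l" for k l
    using f by (auto simp: bij_betw_def inj_on_def)
  have "separated (\<chi> k. if k = i then 0 else 1) (\<chi> k. if k = i then 1 else f k)"
    by (auto simp: separated_def dest: inj)
  then show ?thesis by blast
qed

lemma separated_zeros_differ:
  fixes x y :: "'k ^ 'n"
  assumes "separated x y" "x $ i = 0" "y $ j = 0"
  shows "i \<noteq> j"
proof
  assume "i = j"
  obtain k where "k \<noteq> i" using two_coordinates by metis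
  then have "x $ i * y $ k \<noteq> x $ k * y $ i" using assms(1) by (simp add: separated_def)
  with assms \<open>i = j\<close> show False by simp
qed

text \<open>
  Every constraint used to exclude separated pairs comes from here: any sum or product over
  the ratios is the same for all separated pairs.
\<close>

lemma separated_ratio_bij:
  fixes x y :: "'k ^ 'n"
  assumes sep: "separated x y" and zero: "x $ i = 0" "y $ j = 0"
  shows "bij_betw (\<lambda>k. x $ k / y $ k) (UNIV - {i, j}) (UNIV - {0})"
proof -
  have "i \<noteq> j" using separated_zeros_differ[OF assms] .
  have nz: "x $ k \<noteq> 0" if "k \<noteq> i" for k
    using separatedD[OF sep that] zero by auto
  have nz': "y $ k \<noteq> 0" if "k \<noteq> j" for k
    using separatedD[OF sep that] zero by auto
  have "inj_on (\<lambda>k. x $ k / y $ k) (UNIV - {i, j})"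
  proof (rule inj_onI)
    fix k l assume kl: "k \<in> UNIV - {i, j}" "l \<in> UNIV - {i, j}" "x $ k / y $ k = x $ l / y $ l"
    then have "x $ k * y $ l = x $ l * y $ k" using nz' by (simp add: frac_eq_eq)
    then show "k = l" using separatedD[OF sep] by blast
  qed
  moreover have "(\<lambda>k. x $ k / y $ k) ` (UNIV - {i, j}) \<subseteq> UNIV - {0}" using nz nz' by auto
  moreover have "card (UNIV - {i, j} :: 'n set) = card (UNIV - {0 :: 'k})"
    using \<open>i \<noteq> j\<close> card_n by (simp add: card_Diff_subset)
  ultimately show ?thesis
    by (simp add: bij_betw_def card_image card_subset_eq)
qed

lemma simplex_zero_ex1:
  fixes v :: "'k ^ 'n"
  assumes "simplex_code2 C" "v \<in> C" "v \<noteq> 0"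
  shows "\<exists>!i. v $ i = 0"
  using assms by (simp add: simplex_code2_def flip: weight_eq_iff)

lemma simplex_two_zeros:
  fixes v :: "'k ^ 'n"
  assumes "simplex_code2 C" "v \<in> C" "i \<noteq> j" "v $ i = 0" "v $ j = 0"
  shows "v = 0"
  using simplex_zero_ex1[OF assms(1,2)] assms(3-5) by blast

lemma simplex_same_zero:
  fixes x y :: "'k ^ 'n"
  assumes C: "simplex_code2 C" and x: "x \<in> C" "x $ i = 0" and y: "y \<in> C" "y \<noteq> 0" "y $ i = 0"
  obtains c where "x = c *s y"
proof -
  have sub: "vec.subspace C" using C by (simp add: simplex_code2_def)
  obtain k where k: "y $ k \<noteq> 0" using y(2) by (auto simp: vec_eq_iff)
  then have "i \<noteq> k" using y(3) by blast
  have "x - (x $ k / y $ k) *s y = 0"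
    by (rule simplex_two_zeros[OF C _ \<open>i \<noteq> k\<close>])
      (use sub x y k in \<open>auto intro: vec.subspace_diff vec.subspace_scale\<close>)
  with that show ?thesis by auto
qed

lemma simplex_vanishing_at:
  fixes C :: "('k ^ 'n) set"
  assumes "simplex_code2 C"
  obtains x where "x \<in> C" "x \<noteq> 0" "x $ i = 0"
proof -
  have C: "vec.subspace C" "vec.dim C = 2" using assms by (auto simp: simplex_code2_def)
  obtain B where B: "B \<subseteq> C" "vec.independent B" "card B = 2"
    using vec.basis_exists[of C] C(2) by metis
  obtain x y where xy: "B = {x, y}" "x \<noteq> y" using B(3) by (meson card_2_iff)
  have in_C: "x \<in> C" "y \<in> C" using B xy by auto
  have ind: "x \<noteq> a *s y" "y \<noteq> 0" for a
    using B(2) xy by (auto simp: vec.independent_insert vec.span_singleton)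
  show ?thesis
  proof (cases "y $ i = 0")
    case True
    then show ?thesis using that in_C ind by blast
  next
    case False
    let ?v = "x - (x $ i / y $ i) *s y"
    have "?v \<in> C" using C(1) in_C by (intro vec.subspace_diff vec.subspace_scale)
    moreover have "?v \<noteq> 0" using ind(1)[of "x $ i / y $ i"] by auto
    moreover have "?v $ i = 0" using False by simp
    ultimately show ?thesis using that by blast
  qed
qed

text \<open>
  If the columns at \<open>k\<close> and \<open>l\<close> were proportional, a combination vanishing at \<open>k\<close> would also
  vanish at \<open>l\<close>, hence be zero. Evaluating at \<open>i\<close> gives \<open>x $ k = x $ l = 0\<close>, two zeros of \<open>x\<close>.
\<close>

lemma simplex_separated:
  fixes x y :: "'k ^ 'n"
  assumes C: "simplex_code2 C" and x: "x \<in> C" "x \<noteq> 0" "x $ i = 0"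
    and y: "y \<in> C" "y \<noteq> 0" "y $ j = 0" and ij: "i \<noteq> j"
  shows "separated x y"
  unfolding separated_def
proof (intro allI impI notI)
  fix k l assume kl: "k \<noteq> l" "x $ k * y $ l = x $ l * y $ k"
  have sub: "vec.subspace C" using C by (simp add: simplex_code2_def)
  have yi: "y $ i \<noteq> 0" using simplex_two_zeros[OF C y(1) ij] y by blast
  have "y $ m * x $ i - x $ m * y $ i = 0" if "m = k \<or> m = l" for m
  proof -
    have "y $ m *s x - x $ m *s y = 0"
      by (rule simplex_two_zeros[OF C _ kl(1)])
        (use sub x y that kl(2) in \<open>auto intro: vec.subspace_diff vec.subspace_scale simp: mult.commute\<close>)
    then have "(y $ m *s x - x $ m *s y) $ i = 0" by simp
    then show ?thesis by simp
  qed
  then have "x $ k = 0" "x $ l = 0" using x(3) yi by auto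
  with simplex_two_zeros[OF C x(1) kl(1)] x(2) show False by blast
qed

lemma adjacent_if_share_nonzero:
  fixes x y :: "'k ^ 'n"
  assumes "simplex_code2 C" "simplex_code2 D" "x \<in> C" "x \<in> D" "x \<noteq> 0" "C \<noteq> D"
  shows "(C, D) \<in> parcs simplex_graph2"
proof -
  have C: "vec.subspace C" "vec.dim C = 2" and D: "vec.subspace D" "vec.dim D = 2"
    using assms by (auto simp: simplex_code2_def)
  have CD: "vec.subspace (C \<inter> D)" using C D by (simp add: vec.subspace_inter)
  have "vec.dim (C \<inter> D) \<le> 2" using vec.dim_subset[of "C \<inter> D" C] C by simp
  moreover have "vec.dim (C \<inter> D) \<noteq> 2"
  proof
    assume "vec.dim (C \<inter> D) = 2"
    then have "C \<inter> D = C" "C \<inter> D = D"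
      using vec.subspace_dim_equal[OF CD C(1)] vec.subspace_dim_equal[OF CD D(1)] C D by auto
    with assms(6) show False by blast
  qed
  moreover have "vec.dim (C \<inter> D) \<noteq> 0" using assms(3-5) vec.dim_eq_0[of "C \<inter> D"] by blast
  ultimately have "vec.dim (C \<inter> D) = 1" by linarith
  then show ?thesis using assms by (simp add: simplex_graph2_def)
qed

lemma simplex_inter_nonzero:
  fixes C :: "('k ^ 'n) set"
  assumes "simplex_code2 C" "C = D \<or> (C, D) \<in> parcs simplex_graph2"
  obtains x where "x \<in> C" "x \<in> D" "x \<noteq> 0"
proof -
  have "vec.dim (C \<inter> D) \<noteq> 0" using assms
    by (elim disjE) (simp_all add: simplex_graph2_def simplex_code2_def del: vec.dim_eq_0)
  then have "\<not> C \<inter> D \<subseteq> {0}" by simp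
  then show ?thesis using that by blast
qed

section \<open>The upper bound three\<close>

lemma separatedI:
  fixes x y :: "'k ^ 'n"
  assumes "x $ i = 0" "y $ j = 0" "i \<noteq> j"
    and nz: "\<And>k. k \<noteq> i \<Longrightarrow> x $ k \<noteq> 0" "\<And>k. k \<noteq> j \<Longrightarrow> y $ k \<noteq> 0"
    and inj: "inj_on (\<lambda>k. x $ k / y $ k) (UNIV - {i, j})"
  shows "separated x y"
  unfolding separated_def
proof (intro allI impI notI)
  fix k l assume kl: "k \<noteq> l" "x $ k * y $ l = x $ l * y $ k"
  show False
  proof (cases "{k, l} \<inter> {i, j} = {}")
    case True
    then have "y $ k \<noteq> 0" "y $ l \<noteq> 0" using nz by auto
    then have "x $ k / y $ k = x $ l / y $ l" using kl(2) by (simp add: frac_eq_eq)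
    then show False using inj True kl(1) by (auto dest: inj_onD)
  next
    case False
    then consider "k = i" | "l = i" | "k = j" | "l = j" by blast
    then show False
    proof cases
      case 1 then show ?thesis using kl assms(1-3) nz(1)[of l] nz(2)[of i] by auto
    next
      case 2 then show ?thesis using kl assms(1-3) nz(1)[of k] nz(2)[of i] by auto
    next
      case 3 then show ?thesis using kl assms(1-3) nz(1)[of j] nz(2)[of l] by auto
    next
      case 4 then show ?thesis using kl assms(1-3) nz(1)[of j] nz(2)[of k] by auto
    qed
  qed
qed

text \<open>
  The third vector \<open>z\<close> vanishes at a place \<open>m\<close> different from \<open>i\<close> and \<open>j\<close>. Away from the three
  places both \<open>z $ k / x $ k\<close> and \<open>z $ k / y $ k\<close> have to be distinct, which
  \<open>distinct_multiples\<close> achieves. At \<open>i\<close>, where \<open>x\<close> vanishes, only the ratio to \<open>y\<close> matters,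
  and conversely at \<open>j\<close>; since \<open>q - 2\<close> of the \<open>q - 1\<close> nonzero ratios are in use, exactly one
  is left for each of these places.
\<close>

lemma common_separated_partner:
  fixes x y :: "'k ^ 'n"
  assumes x: "x $ i = 0" "\<And>k. k \<noteq> i \<Longrightarrow> x $ k \<noteq> 0"
    and y: "y $ j = 0" "\<And>k. k \<noteq> j \<Longrightarrow> y $ k \<noteq> 0" and ij: "i \<noteq> j"
  obtains z where "separated x z" "separated y z"
proof -
  have "card {0, 1 :: 'k} \<le> CARD('k)" by (rule card_mono) auto
  then have "card {i, j} < CARD('n)" using card_n ij by simp
  then obtain m where m: "m \<notin> {i, j}" by (metis card_mono finite not_le subsetI)
  define K where "K = UNIV - {i, j, m}"
  have "card {i, j, m} = 3" using m ij by auto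
  then have card_K: "card K + 2 = CARD('k)"
    using card_n card_Diff_subset[of "{i, j, m}" UNIV] card_mono[of UNIV "{i, j, m}"]
    by (simp add: K_def)
  define u where "u k = x $ k / y $ k" for k
  have u: "u k \<noteq> 0" if "k \<in> K" for k using that x y by (auto simp: K_def u_def)
  obtain a where a: "\<And>k. k \<in> K \<Longrightarrow> a k \<noteq> 0" "inj_on a K" "inj_on (\<lambda>k. u k * a k) K"
    using distinct_multiples[of K u] card_K u by auto
  have "card (insert 0 (a ` K)) < CARD('k)"
    using card_K a(2) by (simp add: card_image card_insert_if)
  then obtain p where p: "p \<noteq> 0" "p \<notin> a ` K"
    by (metis card_mono finite not_le subsetI insertCI)
  have "card (insert 0 ((\<lambda>k. u k * a k) ` K)) < CARD('k)"
    using card_K a(3) by (simp add: card_image card_insert_if)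
  then obtain r where r: "r \<noteq> 0" "r \<notin> (\<lambda>k. u k * a k) ` K"
    by (metis card_mono finite not_le subsetI insertCI)
  define z where "z = (\<chi> k. if k = m then 0 else if k = i then y $ i * r
    else if k = j then x $ j * p else x $ k * a k)"
  have z: "z $ m = 0" "z $ i = y $ i * r" "z $ j = x $ j * p" "\<And>k. k \<in> K \<Longrightarrow> z $ k = x $ k * a k"
    using m ij by (auto simp: z_def K_def)
  have K: "k \<in> K \<or> k = i \<or> k = j" if "k \<noteq> m" for k using that by (auto simp: K_def)
  have z_nz: "z $ k \<noteq> 0" if "k \<noteq> m" for k
    using K[OF that] z x y a p r ij by (auto simp: K_def)
  have K': "UNIV - {m, i} = insert j K" "UNIV - {m, j} = insert i K"
    using ij m by (auto simp: K_def)
  have notin: "i \<notin> K" "j \<notin> K" by (auto simp: K_def)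
  have inj_x: "inj_on (\<lambda>k. z $ k / x $ k) (insert j K)"
  proof -
    have "z $ k / x $ k = a k" if "k \<in> K" for k using that z x by (auto simp: K_def)
    moreover have "z $ j / x $ j = p" using z x ij by auto
    ultimately show ?thesis using a(2) p notin by (simp add: inj_on_insert cong: inj_on_cong)
  qed
  have inj_y: "inj_on (\<lambda>k. z $ k / y $ k) (insert i K)"
  proof -
    have "z $ k / y $ k = u k * a k" if "k \<in> K" for k using that z by (simp add: u_def)
    moreover have "z $ i / y $ i = r" using z y ij by auto
    ultimately show ?thesis using a(3) r notin by (simp add: inj_on_insert cong: inj_on_cong)
  qed
  have "separated z x"
    by (rule separatedI[of z m x i]) (use m z(1) z_nz x K'(1) inj_x in auto)
  moreover have "separated z y"
    by (rule separatedI[of z m y j]) (use m z(1) z_nz y K'(2) inj_y in auto)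
  ultimately show ?thesis using that separated_sym by blast
qed

lemma within_three:
  fixes C D :: "('k ^ 'n) set"
  assumes C: "simplex_code2 C" and D: "simplex_code2 D"
  shows "\<exists>m\<le>3. (C, D) \<in> parcs simplex_graph2 ^^ m"
proof (rule relpow_reflcl_imp)
  obtain i j :: 'n where ij: "i \<noteq> j" using two_coordinates by blast
  obtain x where x: "x \<in> C" "x \<noteq> 0" "x $ i = 0" using simplex_vanishing_at[OF C] .
  obtain y where y: "y \<in> D" "y \<noteq> 0" "y $ j = 0" using simplex_vanishing_at[OF D] .
  obtain z where z: "separated x z" "separated y z"
    using common_separated_partner[of x i y j] x y ij simplex_two_zeros[OF C x(1)] simplex_two_zeros[OF D y(1)] by blast
  have "z \<noteq> 0" using z(1) ij by (auto simp: separated_def)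
  note E = simplex_code_span[OF z(1)] and F = simplex_code_span[OF z(2)]
  have mem: "x \<in> vec.span {x, z}" "z \<in> vec.span {x, z}" "y \<in> vec.span {y, z}" "z \<in> vec.span {y, z}"
    by (auto intro: vec.span_base)
  have "(C, vec.span {x, z}) \<in> (parcs simplex_graph2)\<^sup>="
    "(vec.span {x, z}, vec.span {y, z}) \<in> (parcs simplex_graph2)\<^sup>="
    "(vec.span {y, z}, D) \<in> (parcs simplex_graph2)\<^sup>="
    using adjacent_if_share_nonzero[OF C E] adjacent_if_share_nonzero[OF E F] adjacent_if_share_nonzero[OF F D]
      x y mem \<open>z \<noteq> 0\<close> by blast+
  then show "(C, D) \<in> ((parcs simplex_graph2)\<^sup>=) ^^ 3"
    by (auto simp: numeral_3_eq_3 simp del: Un_iff)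
qed

section \<open>Codes far apart for at least five elements\<close>

lemma not_within_one:
  fixes C D :: "('k ^ 'n) set"
  assumes C: "simplex_code2 C" and "C \<inter> D \<subseteq> {0}" "m < 2"
  shows "(C, D) \<notin> parcs simplex_graph2 ^^ m"
proof
  assume "(C, D) \<in> parcs simplex_graph2 ^^ m"
  then have "C = D \<or> (C, D) \<in> parcs simplex_graph2"
    using assms(3) by (auto simp: less_2_cases_iff)
  with simplex_inter_nonzero[OF C] assms(2) show False by blast
qed

text \<open>
  On a path \<open>C\<close>, \<open>E\<close>, \<open>D\<close> the code \<open>E\<close> meets \<open>C\<close> in some \<open>x\<close> and \<open>D\<close> in some \<open>y\<close>. Inside \<open>E\<close>
  these vectors are either separated or, if they have the same zero, proportional, and then
  they lie in \<open>C \<inter> D\<close>.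
\<close>

lemma not_within_two:
  fixes C D :: "('k ^ 'n) set"
  assumes C: "simplex_code2 C" and D: "simplex_code2 D" and disj: "C \<inter> D \<subseteq> {0}"
    and nsep: "\<And>x y. x \<in> C \<Longrightarrow> y \<in> D \<Longrightarrow> \<not> separated x y" and "m < 3"
  shows "(C, D) \<notin> parcs simplex_graph2 ^^ m"
proof
  assume R: "(C, D) \<in> parcs simplex_graph2 ^^ m"
  then have "m = 2" using not_within_one[OF C disj, of m] \<open>m < 3\<close> by fastforce
  with R obtain E where E: "(C, E) \<in> parcs simplex_graph2" "(E, D) \<in> parcs simplex_graph2"
    by (auto simp: numeral_2_eq_2)
  then have simE: "simplex_code2 E" by (auto simp: simplex_graph2_def)
  obtain x where x: "x \<in> C" "x \<in> E" "x \<noteq> 0" using simplex_inter_nonzero[OF C] E by blast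
  obtain y where y: "y \<in> E" "y \<in> D" "y \<noteq> 0" using simplex_inter_nonzero[OF simE] E by blast
  obtain i j where ij: "x $ i = 0" "y $ j = 0" using simplex_zero_ex1[OF simE] x y by metis
  show False
  proof (cases "i = j")
    case True
    then obtain c where "x = c *s y" using simplex_same_zero[OF simE] x y ij by metis
    then have "x \<in> D" using y D by (auto simp: simplex_code2_def intro: vec.subspace_scale)
    then show False using x disj by blast
  next
    case False
    then show False using simplex_separated[OF simE] x y ij nsep by blast
  qed
qed

text \<open>
  Where \<open>d\<close> equals \<open>s\<close> at two places, \<open>rescale d w - s *s w\<close> is a vector of \<open>C\<close> with two
  zeros. With two such values, \<open>w\<close> is multiplied by two different scalars with the same
  result.
\<close>

lemma rescaled_code_disjoint:
  fixes w :: "'k ^ 'n"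
  assumes C: "simplex_code2 C" and "p \<noteq> q" "d p = s" "d q = s"
    and "p' \<noteq> q'" "d p' = t" "d q' = t" and "s \<noteq> t"
    and w: "w \<in> C" "rescale d w \<in> C"
  shows "rescale d w = 0"
proof -
  have sub: "vec.subspace C" using C by (simp add: simplex_code2_def)
  have eq: "rescale d w = c *s w" if "k \<noteq> l" "d k = c" "d l = c" for k l c
  proof -
    have "rescale d w - c *s w = 0"
      by (rule simplex_two_zeros[OF C _ that(1)])
        (use sub w that in \<open>auto intro: vec.subspace_diff vec.subspace_scale\<close>)
    then show ?thesis by simp
  qed
  have "rescale d w = s *s w" "rescale d w = t *s w" using eq assms(2-7) by blast+
  with \<open>s \<noteq> t\<close> have "w = 0" by (metis vec.scale_cancel_right)
  then show ?thesis by (simp add: vec_eq_iff)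
qed

text \<open>
  The zeros \<open>i\<close> and \<open>j\<close> of \<open>x\<close> and \<open>w\<close> are those of \<open>x\<close> and \<open>rescale d w\<close>, and \<open>x, w\<close> is
  separated as well, being a pair in the simplex code \<open>C\<close>. The ratios of both pairs multiply
  to the product of all nonzero field elements, and dividing one product by the other leaves
  the product of the scaling factors.
\<close>

lemma rescaled_code_separated:
  fixes x w :: "'k ^ 'n"
  assumes C: "simplex_code2 C" and d: "\<And>k. d k \<noteq> 0" and w: "x \<in> C" "w \<in> C"
    and sep: "separated x (rescale d w)"
  obtains i j where "i \<noteq> j" "(\<Prod>k\<in>UNIV - {i, j}. d k) = 1"
proof -
  obtain k l :: 'n where "k \<noteq> l" using two_coordinates by blast
  from separatedD[OF sep this] have nz: "x \<noteq> 0" "w \<noteq> 0" by auto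
  obtain i j where ij: "x $ i = 0" "w $ j = 0" using simplex_zero_ex1[OF C] w nz by metis
  have "i \<noteq> j" using separated_zeros_differ[OF sep] ij by simp
  have sep': "separated x w"
    using simplex_separated[OF C w(1) nz(1) ij(1) w(2) nz(2) ij(2) \<open>i \<noteq> j\<close>] .
  let ?K = "UNIV - {i, j}"
  have "(\<Prod>k\<in>?K. x $ k / w $ k) = \<Prod>(UNIV - {0})"
    by (rule prod.reindex_bij_betw[OF separated_ratio_bij[OF sep' ij], of "\<lambda>x. x"])
  moreover have "(\<Prod>k\<in>?K. x $ k / rescale d w $ k) = \<Prod>(UNIV - {0})"
    by (rule prod.reindex_bij_betw[OF separated_ratio_bij[OF sep], of _ _ "\<lambda>x. x"]) (use ij in auto)
  moreover have "(\<Prod>k\<in>?K. x $ k / rescale d w $ k) = (\<Prod>k\<in>?K. x $ k / w $ k) / (\<Prod>k\<in>?K. d k)"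
    by (simp add: prod_dividef prod.distrib mult.commute)
  ultimately have "\<Prod>(UNIV - {0 :: 'k}) / (\<Prod>k\<in>?K. d k) = \<Prod>(UNIV - {0})" by simp
  moreover have "\<Prod>(UNIV - {0 :: 'k}) \<noteq> 0" by simp
  moreover have "(\<Prod>k\<in>?K. d k) \<noteq> 0" using d by simp
  ultimately have "(\<Prod>k\<in>?K. d k) = 1" by (simp add: divide_eq_eq)
  with that \<open>i \<noteq> j\<close> show ?thesis by blast
qed

lemma two_valued_rescaling:
  fixes g :: 'k and T :: "'n set"
  assumes T: "2 \<le> card T" "2 \<le> card (UNIV - T)" and g: "g \<noteq> 0" "g \<noteq> 1"
  obtains C :: "('k ^ 'n) set" and D where "simplex_code2 C" "simplex_code2 D" "C \<inter> D \<subseteq> {0}"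
    "\<And>v. v \<in> D \<longleftrightarrow> (\<exists>w\<in>C. v = rescale (\<lambda>k. if k \<in> T then g else 1) w)"
proof -
  define d where "d k = (if k \<in> T then g else 1)" for k
  obtain x y :: "'k ^ 'n" where xy: "separated x y" using separated_exists by blast
  define C where "C = vec.span {x, y}"
  define D where "D = vec.span {rescale d x, rescale d y}"
  have C: "simplex_code2 C" unfolding C_def by (rule simplex_code_span[OF xy])
  have d: "d k \<noteq> 0" for k using g by (simp add: d_def)
  have D: "simplex_code2 D"
    unfolding D_def by (rule simplex_code_span[OF separated_rescale[OF xy d]])
  have D_iff: "v \<in> D \<longleftrightarrow> (\<exists>w\<in>C. v = rescale d w)" for v
    by (simp add: C_def D_def span_rescale_iff)
  obtain p q where pq: "p \<in> T" "q \<in> T" "p \<noteq> q"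
    using T(1) card_le_Suc0_iff_eq[of T] by auto
  obtain p' q' where pq': "p' \<notin> T" "q' \<notin> T" "p' \<noteq> q'"
    using T(2) card_le_Suc0_iff_eq[of "UNIV - T"] by auto
  have "C \<inter> D \<subseteq> {0}"
  proof
    fix v assume "v \<in> C \<inter> D"
    then obtain w where w: "w \<in> C" "rescale d w \<in> C" "v = rescale d w" using D_iff by auto
    have "d p = g" "d q = g" "d p' = 1" "d q' = 1" using pq pq' by (auto simp: d_def)
    then have "rescale d w = 0"
      using rescaled_code_disjoint[OF C pq(3) _ _ pq'(3) _ _ g(2) w(1,2)] by blast
    with w show "v \<in> {0}" by simp
  qed
  then show ?thesis using that[OF C D] D_iff unfolding d_def by blast
qed

lemma far_codes_ge_5:
  assumes "CARD('k) \<ge> 5"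
  obtains C D :: "('k ^ 'n) set" where "simplex_code2 C" "simplex_code2 D" "C \<inter> D \<subseteq> {0}"
    "\<And>x y. x \<in> C \<Longrightarrow> y \<in> D \<Longrightarrow> \<not> separated x y"
proof -
  obtain g :: 'k where g: "g \<noteq> 0" "g ^ 2 \<noteq> 1" "g ^ 3 \<noteq> 1"
    using exists_order_ge_4[OF assms] by blast
  then have "g \<noteq> 1" by auto
  obtain T :: "'n set" where T: "card T = 3"
    using obtain_subset_with_card_n[of 3 "UNIV :: 'n set"] card_n assms by auto
  then have T': "2 \<le> card T" "2 \<le> card (UNIV - T)"
    using card_n assms by (simp_all add: card_Diff_subset)
  define d where "d k = (if k \<in> T then g else 1)" for k
  have d: "d k \<noteq> 0" for k using g by (simp add: d_def)
  obtain C :: "('k ^ 'n) set" and D where C: "simplex_code2 C" and D: "simplex_code2 D"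
    and disj: "C \<inter> D \<subseteq> {0}" and D_iff: "\<And>v. v \<in> D \<longleftrightarrow> (\<exists>w\<in>C. v = rescale d w)"
    using two_valued_rescaling[OF T' g(1) \<open>g \<noteq> 1\<close>] unfolding d_def by metis
  have "\<not> separated u v" if uv: "u \<in> C" "v \<in> D" for u v
  proof
    assume sep: "separated u v"
    obtain w where w: "w \<in> C" "v = rescale d w" using uv D_iff by auto
    obtain i j where ij: "(\<Prod>k\<in>UNIV - {i, j}. d k) = 1"
      using rescaled_code_separated[OF C d uv(1) w(1) sep[unfolded w(2)]] by blast
    have "(UNIV - {i, j}) \<inter> T = T - {i, j}" by auto
    then have "(\<Prod>k\<in>UNIV - {i, j}. d k) = g ^ card (T - {i, j})"
      by (simp add: d_def prod.If_cases)
    \<comment> \<open>Three scaled coordinates are needed for the exponent to stay positive.\<close>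
    moreover have "card (T - {i, j}) \<in> {1, 2, 3}"
    proof -
      have "card (T - {i, j}) \<ge> card T - card {i, j}" by (rule diff_card_le_card_Diff) simp
      moreover have "card (T - {i, j}) \<le> card T" by (rule card_mono) auto
      moreover have "card {i, j} \<le> 2" by (simp add: card_insert_if)
      ultimately show ?thesis using T by auto
    qed
    ultimately show False using ij g by auto
  qed
  with that C D disj show ?thesis by blast
qed

section \<open>Two and three elements\<close>

lemma unique_code_2:
  fixes C :: "('k ^ 'n) set"
  assumes "CARD('k) = 2" and C: "simplex_code2 C"
  shows "C = insert 0 (range (\<lambda>i. \<chi> j. if j = i then 0 else 1))"
proof -
  have k: "c = 1" if "c \<noteq> 0" for c :: 'k
  proof (rule ccontr)
    assume "c \<noteq> 1"
    then have "card {0, 1, c} = 3" using that by simp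
    moreover have "card {0, 1, c} \<le> CARD('k)" by (rule card_mono) auto
    ultimately show False using assms(1) by simp
  qed
  have v: "v = (\<chi> j. if j = i then 0 else 1)" if "v \<in> C" "v \<noteq> 0" "v $ i = 0" for v i
  proof -
    have "v $ j \<noteq> 0" if "j \<noteq> i" for j
      using simplex_two_zeros[OF C \<open>v \<in> C\<close> that] \<open>v \<noteq> 0\<close> \<open>v $ i = 0\<close> by blast
    then show ?thesis using k \<open>v $ i = 0\<close> by (simp add: vec_eq_iff)
  qed
  show ?thesis
  proof (intro equalityI subsetI)
    fix v assume "v \<in> C"
    then show "v \<in> insert 0 (range (\<lambda>i. \<chi> j. if j = i then 0 else 1))"
      using v simplex_zero_ex1[OF C] by blast
  next
    fix v :: "'k ^ 'n" assume "v \<in> insert 0 (range (\<lambda>i. \<chi> j. if j = i then 0 else 1))"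
    then consider "v = 0" | i where "v = (\<chi> j. if j = i then 0 else 1)" by blast
    then show "v \<in> C"
    proof cases
      case 1
      then show ?thesis using C by (simp add: simplex_code2_def vec.subspace_0)
    next
      case 2
      then show ?thesis using v simplex_vanishing_at[OF C, of i] by metis
    qed
  qed
qed

text \<open>
  Each \<open>x \<in> C\<close> is orthogonal, for the standard bilinear form, to some nonzero \<open>y\<close> in the plane
  \<open>D\<close>. If \<open>x\<close> and \<open>y\<close> have different zeros, the two remaining products, and so the two ratios,
  are opposite, and \<open>x, y\<close> generates a simplex code meeting both \<open>C\<close> and \<open>D\<close>. Otherwise \<open>y\<close> is
  a multiple of \<open>x\<close>, and \<open>C\<close> already meets \<open>D\<close>.
\<close>

lemma within_two_card_3:
  fixes C D :: "('k ^ 'n) set"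
  assumes q: "CARD('k) = 3" and C: "simplex_code2 C" and D: "simplex_code2 D"
  shows "\<exists>m\<le>2. (C, D) \<in> parcs simplex_graph2 ^^ m"
proof (rule relpow_reflcl_imp)
  note F = field_3[OF q]
  have sq: "c * c = 1" if "c \<noteq> 0" for c :: 'k using F(3)[OF that] by auto
  have subD: "vec.subspace D" using D by (simp add: simplex_code2_def)
  define h where "h u v = (\<Sum>k\<in>UNIV. u $ k * v $ k)" for u v :: "'k ^ 'n"
  obtain i j :: 'n where ij: "i \<noteq> j" using two_coordinates by blast
  obtain x where x: "x \<in> C" "x \<noteq> 0" "x $ i = 0" using simplex_vanishing_at[OF C] .
  obtain y where y: "y \<in> D" "y \<noteq> 0" "h x y = 0"
  proof -
    obtain u where u: "u \<in> D" "u \<noteq> 0" "u $ i = 0" using simplex_vanishing_at[OF D] .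
    obtain v where v: "v \<in> D" "v \<noteq> 0" "v $ j = 0" using simplex_vanishing_at[OF D] .
    show ?thesis
    proof (cases "h x u = 0")
      case True
      with u that show ?thesis by blast
    next
      case False
      let ?y = "h x u *s v - h x v *s u"
      have "?y \<in> D" using u v subD by (intro vec.subspace_diff vec.subspace_scale)
      moreover have "v $ i \<noteq> 0" using simplex_two_zeros[OF D v(1) ij _ v(3)] v(2) by blast
      then have "?y $ i \<noteq> 0" using False u(3) by simp
      then have "?y \<noteq> 0" by (metis zero_index)
      moreover have "h x (a *s v - b *s u) = a * h x v - b * h x u" for a b
        by (simp add: h_def sum_distrib_left sum_subtractf algebra_simps)
      then have "h x ?y = 0" by (simp add: mult.commute)
      ultimately show ?thesis using that by blast
    qed
  qed
  have x_nz: "x $ k \<noteq> 0" if "k \<noteq> i" for k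
    using simplex_two_zeros[OF C x(1) that] x by blast
  obtain l where l: "y $ l = 0" using simplex_zero_ex1[OF D y(1,2)] by blast
  have y_nz: "y $ k \<noteq> 0" if "k \<noteq> l" for k
    using simplex_two_zeros[OF D y(1) that] y l by blast
  have "(C, D) \<in> (parcs simplex_graph2)\<^sup>= O (parcs simplex_graph2)\<^sup>="
  proof (cases "i = l")
    case True
    have "card (UNIV - {i}) = 3" using card_n q by simp
    then obtain a b c where abc: "UNIV - {i} = {a, b, c}" "a \<noteq> b" "a \<noteq> c" "b \<noteq> c"
      unfolding card_3_iff by blast
    have "h x y = (\<Sum>k\<in>UNIV - {i}. x $ k * y $ k)"
      unfolding h_def using x(3) by (intro sum.mono_neutral_right) auto
    then have sum: "x $ a * y $ a + x $ b * y $ b + x $ c * y $ c = 0"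
      using abc y(3) by (simp add: add.assoc)
    \<comment> \<open>Three signs add up to zero modulo three only if they agree, so \<open>y\<close> is \<open>x\<close> or \<open>-x\<close>.\<close>
    have signs: "u = s \<and> v = s"
      if "s = 1 \<or> s = - 1" "u = 1 \<or> u = - 1" "v = 1 \<or> v = - 1" "s + u + v = 0" for s u v :: 'k
      using that by auto
    have pm: "x $ k * y $ k = 1 \<or> x $ k * y $ k = - 1" if "k \<noteq> i" for k
      using F(3) x_nz y_nz that True by (metis mult_eq_0_iff)
    have "a \<noteq> i" "b \<noteq> i" "c \<noteq> i" using abc(1) by auto
    define t where "t = x $ a * y $ a"
    from \<open>a \<noteq> i\<close> \<open>b \<noteq> i\<close> \<open>c \<noteq> i\<close> have t: "x $ b * y $ b = t" "x $ c * y $ c = t"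
      unfolding t_def
      using signs[OF pm pm pm sum] by blast+
    have "y $ k = t * x $ k" for k
    proof (cases "k = i")
      case False
      then have "k \<in> {a, b, c}" using abc(1) by blast
      then have "x $ k * y $ k = t" using t t_def by auto
      then have "(x $ k * x $ k) * y $ k = t * x $ k" by (metis mult.assoc mult.commute)
      then show ?thesis using sq[OF x_nz[OF False]] by simp
    qed (use x l True in simp)
    then have "y = t *s x" by (simp add: vec_eq_iff)
    then have "y \<in> C" using C x(1) by (metis simplex_code2_def vec.subspace_scale)
    then have "(C, D) \<in> (parcs simplex_graph2)\<^sup>=" using adjacent_if_share_nonzero[OF C D] y by blast
    then show ?thesis by blast
  next
    case False
    have "card (UNIV - {i, l}) = 2" using card_n q False by (simp add: card_Diff_subset)
    then obtain a b where ab: "UNIV - {i, l} = {a, b}" "a \<noteq> b" unfolding card_2_iff by blast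
    have nz: "x $ a \<noteq> 0" "x $ b \<noteq> 0" "y $ a \<noteq> 0" "y $ b \<noteq> 0" using ab x_nz y_nz by blast+
    have "h x y = (\<Sum>k\<in>UNIV - {i, l}. x $ k * y $ k)"
      unfolding h_def using x(3) l by (intro sum.mono_neutral_right) auto
    then have sum: "x $ a * y $ a + x $ b * y $ b = 0" using ab y(3) by simp
    have "x $ a / y $ a \<noteq> x $ b / y $ b"
    proof
      assume "x $ a / y $ a = x $ b / y $ b"
      moreover have "x $ k / y $ k = x $ k * y $ k" if "y $ k \<noteq> 0" for k
        using sq[OF that] that by (simp add: field_simps)
      ultimately have "x $ a * y $ a = x $ b * y $ b" using nz by simp
      with sum have "(1 + 1) * (x $ a * y $ a) = 0" by (simp add: algebra_simps)
      then show False using F nz by simp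
    qed
    then have "separated x y"
      by (intro separatedI[of x i y l]) (use x(3) l False x_nz y_nz ab in auto)
    then have E: "simplex_code2 (vec.span {x, y})" by (rule simplex_code_span)
    have "x \<in> vec.span {x, y}" "y \<in> vec.span {x, y}" by (auto intro: vec.span_base)
    then have "(C, vec.span {x, y}) \<in> (parcs simplex_graph2)\<^sup>="
      "(vec.span {x, y}, D) \<in> (parcs simplex_graph2)\<^sup>="
      using adjacent_if_share_nonzero[OF C E] adjacent_if_share_nonzero[OF E D] x y by blast+
    then show ?thesis by blast
  qed
  then show "(C, D) \<in> ((parcs simplex_graph2)\<^sup>=) ^^ 2"
    by (auto simp: numeral_2_eq_2 simp del: Un_iff)
qed

lemma disjoint_codes_3:
  assumes q: "CARD('k) = 3"
  obtains C D :: "('k ^ 'n) set" where "simplex_code2 C" "simplex_code2 D" "C \<inter> D \<subseteq> {0}"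
proof -
  obtain T :: "'n set" where T: "card T = 2"
    using obtain_subset_with_card_n[of 2 "UNIV :: 'n set"] card_n q by auto
  then have "2 \<le> card T" "2 \<le> card (UNIV - T)"
    using card_n q by (simp_all add: card_Diff_subset)
  then show ?thesis
    using two_valued_rescaling[of T "- 1"] field_3(2)[OF q] that
    by (metis neg_equal_0_iff_equal zero_neq_one)
qed

section \<open>Codes far apart for four elements\<close>

text \<open>
  Let \<open>v = w\<^sup>2\<close>. The columns of \<open>x1, x2\<close> are the points \<open>0, 1, w, v, \<infinity>\<close> of the projective
  line. Those of \<open>y1, y2\<close> are their images under the Frobenius map, multiplied by \<open>1, 1, w, w,
  v\<close>. As \<open>y\<^sup>2 = 1 / y\<close> for nonzero \<open>y\<close>, the Hermitian form \<open>h\<close> of a separated pair is the sum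
  of its ratios, which is \<open>1 + w + v = 0\<close>. The multipliers are chosen so that on the two codes
  \<open>h\<close> is \<open>w (a e\<^sup>2 + b c\<^sup>2)\<close>. Its vanishing says that the point where \<open>c y1 + e y2\<close> vanishes
  is the one where \<open>a x1 + b x2\<close> does.
\<close>

lemma far_codes_4:
  assumes q: "CARD('k) = 4"
  obtains C D :: "('k ^ 'n) set" where "simplex_code2 C" "simplex_code2 D" "C \<inter> D \<subseteq> {0}"
    "\<And>x y. x \<in> C \<Longrightarrow> y \<in> D \<Longrightarrow> \<not> separated x y"
proof -
  obtain w v :: 'k where U: "UNIV = {0, 1, w, v}" and dist: "distinct [0, 1, w, v]"
    and mult: "w * w = v" "v * v = w" "w * v = 1" "v * w = 1"
    and char2: "\<And>x :: 'k. x + x = 0"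
    and add: "1 + w = v" "w + 1 = v" "1 + v = w" "v + 1 = w" "w + v = 1" "v + w = 1"
    using field_4[OF q] by blast
  note arith = mult add char2
  have nz: "w \<noteq> 0" "v \<noteq> 0" "w \<noteq> 1" "v \<noteq> 1" "w \<noteq> v" using dist by auto
  note nz' = nz nz[symmetric]
  have elem: "P c" if "P 0" "P 1" "P w" "P v" for P and c :: 'k
  proof -
    have "c \<in> {0, 1, w, v}" unfolding U[symmetric] by simp
    then show ?thesis using that by auto
  qed
  obtain xs :: "'n list" where xs: "set xs = UNIV" "distinct xs"
    using finite_distinct_list[of "UNIV :: 'n set"] by auto
  then have "length xs = 5" using card_n q distinct_card[of xs] by simp
  then obtain i0 i1 i2 i3 i4 where "xs = [i0, i1, i2, i3, i4]"
    by (auto simp: eval_nat_numeral length_Suc_conv)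
  with xs have I: "UNIV = {i0, i1, i2, i3, i4}" and dI: "distinct [i0, i1, i2, i3, i4]" by simp_all
  have all_I: "(\<forall>k. P k) \<longleftrightarrow> P i0 \<and> P i1 \<and> P i2 \<and> P i3 \<and> P i4" for P
  proof -
    have "(\<forall>k. P k) \<longleftrightarrow> (\<forall>k\<in>{i0, i1, i2, i3, i4}. P k)" unfolding I[symmetric] by simp
    then show ?thesis by simp
  qed
  have sum_I: "(\<Sum>k\<in>UNIV. f k) = f i0 + f i1 + f i2 + f i3 + f i4" for f :: "'n \<Rightarrow> 'k"
    unfolding I using dI by (simp add: add.assoc)
  define vec5 :: "'k \<Rightarrow> 'k \<Rightarrow> 'k \<Rightarrow> 'k \<Rightarrow> 'k \<Rightarrow> 'k ^ 'n" where
    "vec5 a b c d e = (\<chi> k. if k = i0 then a else if k = i1 then b else if k = i2 then c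
      else if k = i3 then d else e)" for a b c d e
  have vec5 [simp]: "vec5 a b c d e $ i0 = a" "vec5 a b c d e $ i1 = b" "vec5 a b c d e $ i2 = c"
    "vec5 a b c d e $ i3 = d" "vec5 a b c d e $ i4 = e" for a b c d e
    using dI by (auto simp: vec5_def)
  define x1 where "x1 = vec5 1 1 1 1 0"
  define x2 where "x2 = vec5 0 1 w v 1"
  define y1 where "y1 = vec5 1 1 w w 0"
  define y2 where "y2 = vec5 0 1 1 v v"
  have "separated x1 x2" "separated y1 y2"
    unfolding separated_def all_I x1_def x2_def y1_def y2_def using dI nz' by (auto simp: arith)
  note codes = this[THEN simplex_code_span]
  define h where "h x y = (\<Sum>k\<in>UNIV. x $ k * (y $ k * y $ k))" for x y :: "'k ^ 'n"
  have cube: "y * (y * y) = 1" if "y \<noteq> 0" for y :: 'k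
    using that by (induction y rule: elem) (auto simp: arith)
  have h_zero: "h x y = 0" if sep: "separated x y" and ij: "x $ i = 0" "y $ j = 0" for x y i j
  proof -
    have y: "y $ k \<noteq> 0" if "k \<noteq> j" for k
      using separatedD[OF sep that] ij by auto
    have "h x y = (\<Sum>k\<in>UNIV - {i, j}. x $ k * (y $ k * y $ k))"
      unfolding h_def using ij by (intro sum.mono_neutral_right) auto
    also have "\<dots> = (\<Sum>k\<in>UNIV - {i, j}. x $ k / y $ k)"
      using cube[OF y] by (intro sum.cong refl) (simp add: eq_divide_eq y mult_ac)
    also have "\<dots> = \<Sum>(UNIV - {0})"
      by (rule sum.reindex_bij_betw[OF separated_ratio_bij[OF sep ij], of "\<lambda>x. x"])
    also have "UNIV - {0 :: 'k} = {1, w, v}" using U nz' by auto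
    also have "\<Sum>{1, w, v} = 0" using nz' by (simp add: arith)
    finally show ?thesis .
  qed
  have frob: "(s + t) * (s + t) = s * s + t * t" for s t :: 'k
  proof -
    have "(s + t) * (s + t) = (s * s + t * t) + (s * t + s * t)" by (simp add: algebra_simps)
    then show ?thesis by (simp only: char2 add_0_right)
  qed
  have sq_inj: "s = t" if "s * s = t * t" for s t :: 'k
  proof -
    have "(s + t) * (s + t) = 0" using that by (simp only: frob char2)
    then show ?thesis by (metis add_right_cancel char2 mult_eq_0_iff)
  qed
  have h_eq: "h (a *s x1 + b *s x2) (c *s y1 + e *s y2) = w * (a * (e * e) + b * (c * c))" for a b c e
  proof -
    have sq: "(c * s + e * t) * (c * s + e * t) = (c * c) * (s * s) + (e * e) * (t * t)" for s t
      by (simp add: frob mult_ac)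
    \<comment> \<open>The four coefficients of the form, each the sum of the contributions of the coordinates.\<close>
    define X Y where "X = c * c" and "Y = e * e"
    have "h (a *s x1 + b *s x2) (c *s y1 + e *s y2) =
        a * X + (a + b) * (X + Y) + (a + b * w) * (X * v + Y) + (a + b * v) * (X * v + Y * w) + b * (Y * w)"
      unfolding h_def sum_I x1_def x2_def y1_def y2_def vector_add_component vector_smult_component
        vec5 sq by (simp add: mult X_def Y_def)
    also have "\<dots> = a * X * ((1 + 1) + (v + v)) + a * Y * ((1 + 1) + w) +
        b * X * ((1 + w * v) + v * v) + b * Y * ((1 + v * w) + (w + w))"
      by (simp add: algebra_simps)
    also have "\<dots> = w * (a * Y + b * X)"
      by (simp only: arith add_0_left add_0_right mult_zero_right) (simp add: algebra_simps)
    finally show ?thesis by (simp add: X_def Y_def)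
  qed
  have common_zero: "\<exists>k. (a *s x1 + b *s x2) $ k = 0 \<and> (c *s y1 + e *s y2) $ k = 0"
    if h0: "h (a *s x1 + b *s x2) (c *s y1 + e *s y2) = 0" and ab: "a \<noteq> 0 \<or> b \<noteq> 0" for a b c e
  proof (cases "b = 0")
    case True
    then have "e = 0" using h0 ab nz unfolding h_eq by auto
    with True have "(a *s x1 + b *s x2) $ i4 = 0 \<and> (c *s y1 + e *s y2) $ i4 = 0"
      by (simp add: x1_def y1_def)
    then show ?thesis by blast
  next
    case False
    \<comment> \<open>The vector \<open>a x1 + b x2\<close> vanishes at the point \<open>t\<close> of the affine line.\<close>
    obtain t where t: "a = t * b" using False by (metis nonzero_eq_divide_eq)
    have "w * (a * (e * e) + b * (c * c)) = 0" using h0 unfolding h_eq .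
    moreover have "w * (a * (e * e) + b * (c * c)) = w * b * (t * (e * e) + c * c)"
      by (simp add: t algebra_simps)
    ultimately have "t * (e * e) + c * c = 0" using False nz by simp
    then have cc: "c * c = t * (e * e)" by (metis add_right_cancel char2)
    have "t \<in> {0, 1, w, v}" unfolding U[symmetric] by simp
    then consider "t = 0" | "t = 1" | "t = w" | "t = v" by blast
    then show ?thesis
    proof cases
      case 1
      then have "(a *s x1 + b *s x2) $ i0 = 0 \<and> (c *s y1 + e *s y2) $ i0 = 0"
        using cc t by (simp add: x1_def x2_def y1_def y2_def)
      then show ?thesis by blast
    next
      case 2
      then have "c = e" using cc sq_inj[of c e] by simp
      with 2 t have "(a *s x1 + b *s x2) $ i1 = 0 \<and> (c *s y1 + e *s y2) $ i1 = 0"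
        by (simp add: x1_def x2_def y1_def y2_def char2)
      then show ?thesis by blast
    next
      case 3
      have "v * e * (v * e) = (v * v) * (e * e)" by (simp add: mult_ac)
      then have "c = v * e" using cc 3 sq_inj[of c "v * e"] by (simp add: mult)
      then have "c * w = e" by (metis mult.commute mult.assoc mult.left_neutral mult(3))
      with 3 t have "(a *s x1 + b *s x2) $ i2 = 0 \<and> (c *s y1 + e *s y2) $ i2 = 0"
        by (simp add: x1_def x2_def y1_def y2_def char2 mult.commute[of b])
      then show ?thesis by blast
    next
      case 4
      have "w * e * (w * e) = (w * w) * (e * e)" by (simp add: mult_ac)
      then have "c = w * e" using cc 4 sq_inj[of c "w * e"] by (simp add: mult)
      then have "c * w = e * v" by (metis mult.commute mult.assoc mult(1))
      with 4 t have "(a *s x1 + b *s x2) $ i3 = 0 \<and> (c *s y1 + e *s y2) $ i3 = 0"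
        by (simp add: x1_def x2_def y1_def y2_def char2 mult.commute[of b])
      then show ?thesis by blast
    qed
  qed
  show ?thesis
  proof (rule that[OF codes])
    show "vec.span {x1, x2} \<inter> vec.span {y1, y2} \<subseteq> {0}"
    proof
      fix u assume "u \<in> vec.span {x1, x2} \<inter> vec.span {y1, y2}"
      then obtain a b c e where u: "u = a *s x1 + b *s x2" "u = c *s y1 + e *s y2"
        unfolding Int_iff span_pair_iff by blast
      then have eq: "(a *s x1 + b *s x2) $ k = (c *s y1 + e *s y2) $ k" for k by metis
      have "a = c" "a + b = c + e" "a + b * w = c * w + e" "b = e * v"
        using eq[of i0] eq[of i1] eq[of i2] eq[of i4]
        by (simp_all only: x1_def x2_def y1_def y2_def vector_add_component vector_smult_component
            vec5 mult_1_right mult_zero_right add_0_left add_0_right)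
      then have "b = b * v" by (metis add_left_cancel)
      then have "b = 0" using nz' by simp
      with \<open>a = c\<close> \<open>a + b = c + e\<close> \<open>a + b * w = c * w + e\<close> have "a = a * w" by simp
      then have "a = 0" using nz' by simp
      with \<open>b = 0\<close> u show "u \<in> {0}" by simp
    qed
  next
    fix x y assume xy: "x \<in> vec.span {x1, x2}" "y \<in> vec.span {y1, y2}"
    show "\<not> separated x y"
    proof
      assume sep: "separated x y"
      obtain k l :: 'n where "k \<noteq> l" using two_coordinates by blast
      from separatedD[OF sep this] have "x \<noteq> 0" "y \<noteq> 0" by auto
      then obtain i j where ij: "x $ i = 0" "y $ j = 0"
        using simplex_zero_ex1[OF codes(1) xy(1)] simplex_zero_ex1[OF codes(2) xy(2)] by blast
      obtain a b c e where abce: "x = a *s x1 + b *s x2" "y = c *s y1 + e *s y2"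
        using xy unfolding span_pair_iff by blast
      have "a \<noteq> 0 \<or> b \<noteq> 0" using \<open>x \<noteq> 0\<close> abce(1) by auto
      from common_zero[OF h_zero[OF sep ij, unfolded abce] this]
      obtain k where "x $ k = 0" "y $ k = 0" unfolding abce by blast
      then show False using separated_zeros_differ[OF sep] by blast
    qed
  qed
qed

end

section \<open>The diameter\<close>

theorem theorem1p1:
  fixes q :: nat
  assumes "primepow q"
    and "CARD('k::{field,finite}) = q"
    and "CARD('n::finite) = q + 1"
  shows "graph_diameter (with_proj (simplex_graph2 :: ('k ^ 'n) set pair_pre_digraph)) =
           (if q = 2 then 0 else if q = 3 then 2 else 3)"
proof -
  have card_n: "CARD('n) = CARD('k) + 1" using assms by simp
  let ?G = "simplex_graph2 :: ('k ^ 'n) set pair_pre_digraph"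
  note diameter = graph_diameter_eqI[OF wf_digraph_simplex_graph2]
  have verts: "C \<in> pverts ?G \<longleftrightarrow> simplex_code2 C" for C by (simp add: simplex_graph2_def)
  have "card {0, 1 :: 'k} \<le> CARD('k)" by (rule card_mono) auto
  then consider "q = 2" | "q = 3" | "q \<ge> 4" using assms(2) by fastforce
  then show ?thesis
  proof cases
    case 1
    then have k: "CARD('k) = 2" using assms(2) by simp
    obtain x y :: "'k ^ 'n" where "separated x y" using separated_exists[OF card_n] by blast
    then have C: "simplex_code2 (vec.span {x, y})" by (rule simplex_code_span[OF card_n])
    have "graph_diameter (with_proj ?G) = ereal (real 0)"
    proof (rule diameter)
      fix C D assume "C \<in> pverts ?G" "D \<in> pverts ?G"
      then have "C = D" using unique_code_2[OF card_n k] unfolding verts by metis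
      then show "\<exists>m\<le>0. (C, D) \<in> parcs ?G ^^ m" by simp
    qed (use C verts in auto)
    then show ?thesis using 1 by simp
  next
    case 2
    then have k: "CARD('k) = 3" using assms(2) by simp
    obtain C D :: "('k ^ 'n) set" where CD: "simplex_code2 C" "simplex_code2 D" "C \<inter> D \<subseteq> {0}"
      using disjoint_codes_3[OF card_n k] by blast
    have "graph_diameter (with_proj ?G) = ereal (real 2)"
      by (rule diameter[where u = C and v = D])
        (use CD verts within_two_card_3[OF card_n k] not_within_one[OF card_n CD(1,3)] in auto)
    then show ?thesis using 2 by simp
  next
    case 3
    obtain C D :: "('k ^ 'n) set" where CD: "simplex_code2 C" "simplex_code2 D" "C \<inter> D \<subseteq> {0}"
      "\<And>x y. x \<in> C \<Longrightarrow> y \<in> D \<Longrightarrow> \<not> separated x y"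
    proof (cases "q = 4")
      case True
      with assms(2) have "CARD('k) = 4" by simp
      with that show ?thesis using far_codes_4[OF card_n] by metis
    next
      case False
      with 3 assms(2) have "CARD('k) \<ge> 5" by simp
      with that show ?thesis using far_codes_ge_5[OF card_n] by metis
    qed
    have "graph_diameter (with_proj ?G) = ereal (real 3)"
      by (rule diameter[where u = C and v = D])
        (use CD verts within_three[OF card_n] not_within_two[OF card_n CD] in auto)
    then show ?thesis using 3 by simp
  qed
qed

end
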